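(* Let $\mu,\nu\in\mathbb{C}$ with $\operatorname{Re}(\mu+\nu)<0$, and let $x>0$ and $y>0$ be real. Then $$ \begin{aligned} &\int_0^\infty t^{-(1+\mu+\nu)}\exp\left(-\frac{x+y}{4xy}t^2\right){}_2F_2\left(-\mu,-\nu;-\frac{\mu+\nu}{2},\frac{1-\mu-\nu}{2};\frac{t^2}{8x}\right)dt\\ &=2^{-(1+\mu+\nu)}\,\Gamma\left[-\frac{\mu+\nu}{2}\right]\left(\frac{x+y}{xy}\right)^{(\mu+\nu)/2}{}_2F_1\left(-\frac{\mu}{2},-\frac{\nu}{2};\frac{1-\mu-\nu}{2};\frac{y(2x+y)}{(x+y)^2}\right). \end{aligned} $$
   Context: $\Gamma[\cdot]$ is the gamma function, ${}_2F_1(a,b;c;z)$ is the Gaussian hypergeometric function, and ${}_2F_2(a_1,a_2;b_1,b_2;z)=\sum_{n\ge0}\frac{(a_1)_n(a_2)_n}{(b_1)_n(b_2)_n}\frac{z^n}{n!}$ is the generalized hypergeometric function. *)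

theory Defs
  imports "HOL-Analysis.Analysis"
begin

(* Value of the Gauss series. Outside the unit disc this is not the analytic
   continuation of the hypergeometric function, so use it only for norm z < 1. *)
definition hyp2F1 :: "complex \<Rightarrow> complex \<Rightarrow> complex \<Rightarrow> complex \<Rightarrow> complex" where
  "hyp2F1 a b c z = eval_fps (fps_hypergeo [a, b] [c] 1) z"

definition hyp2F2 ::
  "complex \<Rightarrow> complex \<Rightarrow> complex \<Rightarrow> complex \<Rightarrow> complex \<Rightarrow> complex" where
  "hyp2F2 a1 a2 b1 b2 z = eval_fps (fps_hypergeo [a1, a2] [b1, b2] 1) z"

lemma hyp2F1_series:
  "hyp2F1 a b c z =
     (\<Sum>n. pochhammer a n * pochhammer b n / pochhammer c n * (z ^ n / fact n))"
  by (simp add: hyp2F1_def eval_fps_def)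

lemma hyp2F2_series:
  "hyp2F2 a1 a2 b1 b2 z =
     (\<Sum>n. pochhammer a1 n * pochhammer a2 n / (pochhammer b1 n * pochhammer b2 n)
            * (z ^ n / fact n))"
  by (simp add: hyp2F2_def eval_fps_def)

(* The argument of hyp2F1 in the integral formula lies in the disc of convergence. *)
lemma hyp2F1_argument_in_unit_disc:
  fixes x y :: real
  assumes "x > 0" and "y > 0"
  shows "norm (complex_of_real (y * (2 * x + y) / (x + y)^2)) < 1"
proof -
  have "0 < y * (2 * x + y) / (x + y)^2"
    using assms by (intro divide_pos_pos mult_pos_pos) auto
  moreover have "y * (2 * x + y) < (x + y)^2"
    using assms by (simp add: power2_eq_square algebra_simps)
  hence "y * (2 * x + y) / (x + y)^2 < 1"
    using assms by simp
  ultimately show ?thesis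
    unfolding norm_of_real by linarith
qed

end

theory Submission
  imports Defs "HOL-Complex_Analysis.Complex_Analysis"
begin

text \<open>
  With \<open>s = - (\<mu> + \<nu>)\<close>, \<open>p = (x + y) / (4xy)\<close> and \<open>w = y / (2(x + y)) < 1/2\<close>, integrating the
  \<open>2F2\<close> series term by term against the Gaussian cancels the parameter \<open>s/2\<close> and leaves
  \<open>p powr (- s/2) * Gamma (s/2) / 2 * 2F1(-\<mu>, -\<nu>; (1 + s)/2; w)\<close>. Gauss's quadratic transformation
  \<open>2F1(a, b; (a + b + 1)/2; w) = 2F1(a/2, b/2; (a + b + 1)/2; 4w(1 - w))\<close> then gives the claim.
  The transformation holds near \<open>0\<close> because both sides solve the same hypergeometric equation,
  whose power series solution is determined by its constant term, and extends to \<open>0 \<le> w < 1/2\<close>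
  by analytic continuation, as \<open>4w(1 - w)\<close> stays below \<open>1\<close> there.
\<close>

section \<open>Ratio test for hypergeometric terms\<close>

text \<open>The ratio enters as a factor \<open>R n\<close>, not as a quotient of norms, so series
  whose terms eventually vanish are covered as well. This happens when a numerator parameter is a
  nonpositive integer.\<close>

lemma summable_ratio_limit:
  fixes f :: "nat \<Rightarrow> 'a::banach"
  assumes "R \<longlonglongrightarrow> L" "L < 1" "\<And>n. norm (f (Suc n)) = R n * norm (f n)"
  shows "summable f"
proof -
  obtain c where c: "L < c" "c < 1" using dense[OF assms(2)] by blast
  have "eventually (\<lambda>n. R n < c) sequentially" by (rule order_tendstoD(2)[OF assms(1) c(1)])
  then obtain N where N: "\<And>n. n \<ge> N \<Longrightarrow> R n < c" by (auto simp: eventually_sequentially)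
  show ?thesis
  proof (rule summable_ratio_test[OF c(2)])
    fix n assume "n \<ge> N"
    then show "norm (f (Suc n)) \<le> c * norm (f n)"
      unfolding assms(3) by (intro mult_right_mono less_imp_le[OF N]) auto
  qed
qed

lemma tendsto_shifted_ratio:
  fixes a b :: "'a::real_normed_field"
  shows "(\<lambda>n. (a + of_nat n) / (b + of_nat n)) \<longlonglongrightarrow> 1"
proof -
  have lim: "filterlim (\<lambda>n. b + of_nat n) at_infinity sequentially"
    by (intro tendsto_add_filterlim_at_infinity[OF tendsto_const] tendsto_of_nat)
  have nz: "eventually (\<lambda>n. b + of_nat n \<noteq> 0) sequentially"
    using filterlim_at_infinity_imp_eventually_ne[OF lim] .
  have "(\<lambda>n. 1 + (a - b) / (b + of_nat n)) \<longlonglongrightarrow> 1 + 0"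
    by (intro tendsto_add tendsto_const tendsto_divide_0[OF tendsto_const lim])
  moreover have "eventually (\<lambda>n. 1 + (a - b) / (b + of_nat n) = (a + of_nat n) / (b + of_nat n)) sequentially"
    using nz by eventually_elim (simp add: field_simps)
  ultimately show ?thesis using Lim_transform_eventually by fastforce
qed

lemma plus_of_nat_neq_0:
  assumes "(c::complex) \<notin> \<int>\<^sub>\<le>\<^sub>0" shows "c + of_nat n \<noteq> 0"
  using assms plus_of_nat_eq_0_imp by blast

section \<open>Convergence and holomorphy of the Gauss series\<close>

text \<open>Successive terms have ratio tending to \<open>r\<close>, since each shifted quotient of
  parameters tends to 1. If \<open>c\<close> is a nonpositive integer, division by zero sets all
  later coefficients to 0, and the recurrence remains valid.\<close>

lemma fps_conv_radius_hypergeo_2F1: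
  fixes a b c :: complex
  shows "fps_conv_radius (fps_hypergeo [a, b] [c] 1) \<ge> 1"
  unfolding fps_conv_radius_def
proof (rule conv_radius_geI_ex')
  fix r :: real assume r: "0 < r" "ereal r < 1"
  let ?f = "\<lambda>n. fps_nth (fps_hypergeo [a, b] [c] 1) n * of_real r ^ n"
  let ?R = "\<lambda>n. norm ((a + of_nat n) / (c + of_nat n)) * norm ((b + of_nat n) / (1 + of_nat n)) * r"
  show "summable ?f"
  proof (rule summable_ratio_limit)
    have "?R \<longlonglongrightarrow> norm (1 :: complex) * norm (1 :: complex) * r"
      by (intro tendsto_intros tendsto_shifted_ratio)
    then show "?R \<longlonglongrightarrow> r" by simp
    show "r < 1" using r by (simp add: one_ereal_def)
    fix n
    have "?f (Suc n) = (a + of_nat n) / (c + of_nat n) * ((b + of_nat n) / (1 + of_nat n)) * of_real r * ?f n"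
      unfolding fps_hypergeo_rec by (simp del: fps_hypergeo_nth add: ac_simps)
    then show "norm (?f (Suc n)) = ?R n * norm (?f n)"
      using r by (simp only: norm_mult norm_of_real)
  qed
qed

lemma holomorphic_hyp2F1: "hyp2F1 a b c holomorphic_on ball 0 1"
proof -
  have "ball 0 1 \<subseteq> eball 0 (fps_conv_radius (fps_hypergeo [a, b] [c] 1))"
    using fps_conv_radius_hypergeo_2F1[of a b c]
    by (auto simp: in_eball_iff intro: less_le_trans simp flip: ereal_less)
  then show ?thesis
    unfolding hyp2F1_def by (rule holomorphic_on_eval_fps)
qed

lemma has_fps_expansion_hyp2F1: "hyp2F1 a b c has_fps_expansion fps_hypergeo [a, b] [c] 1"
  unfolding hyp2F1_def
  by (rule eval_fps_has_fps_expansion) (use fps_conv_radius_hypergeo_2F1[of a b c] in \<open>auto intro: less_le_trans[of _ 1]\<close>)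

section \<open>The hypergeometric equation for formal power series\<close>

text \<open>Gauss's equation is posed on formal series, so that uniqueness becomes a statement about
  a coefficient recurrence and a change of variable becomes composition of series.\<close>

definition hypergeo_ode :: "complex \<Rightarrow> complex \<Rightarrow> complex \<Rightarrow> complex fps \<Rightarrow> bool" where
  "hypergeo_ode a b c F \<longleftrightarrow>
     fps_X * (1 - fps_X) * fps_deriv (fps_deriv F)
     + (fps_const c - fps_const (a + b + 1) * fps_X) * fps_deriv F = fps_const (a * b) * F"

text \<open>Compare coefficients of \<open>X^n\<close>. Index \<open>n + 1\<close> collects
  \<open>n(n+1) + c(n+1) = (n+1)(c+n)\<close>, and index \<open>n\<close> collects
  \<open>n(n-1) + (a+b+1)n + ab = (a+n)(b+n)\<close>.\<close>

lemma hypergeo_ode_iff: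
  "hypergeo_ode a b c F \<longleftrightarrow>
     (\<forall>n. of_nat (Suc n) * (c + of_nat n) * fps_nth F (Suc n)
          = (a + of_nat n) * (b + of_nat n) * fps_nth F n)"
proof -
  have eq: "fps_X * (1 - fps_X) * fps_deriv (fps_deriv F)
      + (fps_const c - fps_const (a + b + 1) * fps_X) * fps_deriv F
    = fps_X * fps_deriv (fps_deriv F) - fps_X * (fps_X * fps_deriv (fps_deriv F))
      + fps_const c * fps_deriv F - fps_const (a + b + 1) * (fps_X * fps_deriv F)"
    by (simp add: algebra_simps)
  have "fps_nth (fps_X * fps_deriv (fps_deriv F) - fps_X * (fps_X * fps_deriv (fps_deriv F))
      + fps_const c * fps_deriv F - fps_const (a + b + 1) * (fps_X * fps_deriv F)) n
      - fps_nth (fps_const (a * b) * F) n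
    = of_nat (Suc n) * (c + of_nat n) * fps_nth F (Suc n) - (a + of_nat n) * (b + of_nat n) * fps_nth F n" for n
  proof (cases n)
    case (Suc m)
    then show ?thesis by (cases m) (simp_all add: algebra_simps)
  qed (simp add: algebra_simps)
  then show ?thesis
    unfolding hypergeo_ode_def eq fps_eq_iff by (metis eq_iff_diff_eq_0)
qed

lemma hypergeo_ode_fps_hypergeo:
  assumes "c \<notin> \<int>\<^sub>\<le>\<^sub>0"
  shows "hypergeo_ode a b c (fps_hypergeo [a, b] [c] 1)"
  unfolding hypergeo_ode_iff fps_hypergeo_rec
  using plus_of_nat_neq_0[OF assms] by (auto simp del: fps_hypergeo_nth of_nat_Suc)

text \<open>For such \<open>c\<close> the factor \<open>(n+1)(c+n)\<close> never vanishes, so the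
  recurrence can be solved for each next coefficient.\<close>

lemma hypergeo_ode_unique:
  assumes "c \<notin> \<int>\<^sub>\<le>\<^sub>0" "hypergeo_ode a b c F" "hypergeo_ode a b c G" "fps_nth F 0 = fps_nth G 0"
  shows "F = G"
proof (rule fps_ext)
  fix n show "fps_nth F n = fps_nth G n"
  proof (induction n)
    case (Suc n)
    have "of_nat (Suc n) * (c + of_nat n) * fps_nth F (Suc n) = of_nat (Suc n) * (c + of_nat n) * fps_nth G (Suc n)"
      using assms(2,3) Suc unfolding hypergeo_ode_iff by simp
    moreover have "of_nat (Suc n) * (c + of_nat n) \<noteq> 0"
      using plus_of_nat_neq_0[OF assms(1)] by (simp del: of_nat_Suc)
    ultimately show ?case by (simp only: mult_cancel_left) blast
  qed (fact assms(4))
qed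

section \<open>Gauss's quadratic transformation\<close>

text \<open>Everything rests on \<open>1 - P = (1 - 2X)^2\<close>. It gives
  \<open>X(1-X) P'^2 = 4P(1-P)\<close> for the second-order term. The choice of \<open>c\<close>
  makes \<open>c - (a+b+1)X = c(1-2X)\<close>, so its product with \<open>P' = 4(1-2X)\<close> is
  \<open>4c(1-P)\<close>, again a function of \<open>P\<close> alone.\<close>

lemma hypergeo_ode_quadratic:
  fixes a b :: complex
  defines "c \<equiv> (a + b + 1) / 2" and "P \<equiv> 4 * fps_X * (1 - fps_X)"
  assumes "hypergeo_ode (a / 2) (b / 2) c F"
  shows "hypergeo_ode a b c (F oo P)"
proof -
  have P0: "fps_nth P 0 = 0" by (simp add: P_def)
  define D1 D2 where "D1 = fps_deriv F oo P" and "D2 = fps_deriv (fps_deriv F) oo P"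
  define K where "K = fps_const c"
  have dP: "fps_deriv P = 4 * (1 - 2 * fps_X)"
    by (simp add: P_def algebra_simps)
  have d1: "fps_deriv (F oo P) = D1 * (4 * (1 - 2 * fps_X))"
    unfolding D1_def dP[symmetric] by (rule fps_compose_deriv[OF P0])
  have dD1: "fps_deriv D1 = D2 * (4 * (1 - 2 * fps_X))"
    unfolding D1_def D2_def dP[symmetric] by (rule fps_compose_deriv[OF P0])
  have d2: "fps_deriv (fps_deriv (F oo P)) = D2 * (4 * (1 - 2 * fps_X))\<^sup>2 - 8 * D1"
    unfolding d1 by (simp add: dD1 power2_eq_square algebra_simps)
  have c2: "fps_const (a + b + 1) = 2 * K" "fps_const (a / 2 + b / 2 + 1) = K + fps_const (1/2)"
    by (simp_all add: K_def c_def fps_const_add[symmetric] numeral_fps_const field_simps del: fps_const_add)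
  have "(fps_X * (1 - fps_X) * fps_deriv (fps_deriv F)
     + (fps_const c - fps_const (a / 2 + b / 2 + 1) * fps_X) * fps_deriv F) oo P = (fps_const (a / 2 * (b / 2)) * F) oo P"
    using assms(3) unfolding hypergeo_ode_def by simp
  then have "P * (1 - P) * D2 + (K - (K + fps_const (1/2)) * P) * D1 = fps_const (a / 2 * (b / 2)) * (F oo P)"
    unfolding c2 by (simp add: fps_compose_add_distrib fps_compose_mult_distrib[OF P0] fps_compose_sub_distrib
        D1_def D2_def K_def P0)
  \<comment> \<open>The factor 4 turns the product \<open>ab/4\<close> of the halved parameters into
    \<open>ab\<close>.\<close>
  then have "4 * (P * (1 - P) * D2 + (K - (K + fps_const (1/2)) * P) * D1) = 4 * fps_const (a / 2 * (b / 2)) * (F oo P)"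
    by (simp only: mult.assoc)
  moreover have "4 * fps_const (a / 2 * (b / 2)) = fps_const (a * b)"
    by (simp add: numeral_fps_const)
  moreover have "4 * (P * (1 - P) * D2 + (K - (K + fps_const (1/2)) * P) * D1) =
     4 * P * (1 - P) * D2 + (4 * K - 4 * K * P) * D1 - 2 * P * D1"
  proof -
    have "4 * fps_const (1 / 2 :: complex) = 2" by (simp add: numeral_fps_const)
    moreover have "4 * (P * (1 - P) * D2 + (K - (K + fps_const (1/2)) * P) * D1) =
        4 * P * (1 - P) * D2 + (4 * K - 4 * K * P) * D1 - (4 * fps_const (1/2)) * P * D1"
      by (simp only: ring_distribs mult.assoc)
         (simp only: diff_add_eq diff_diff_eq add_diff_eq add.assoc mult.left_commute)
    ultimately show ?thesis by (simp only:)
  qed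
  ultimately have "4 * P * (1 - P) * D2 + (4 * K - 4 * K * P) * D1 - 2 * P * D1 = fps_const (a * b) * (F oo P)"
    by (simp only:)
  then show ?thesis
    unfolding hypergeo_ode_def d2 unfolding d1 c2 K_def[symmetric]
    by (simp add: P_def power2_eq_square algebra_simps)
qed

text \<open>The bound \<open>w < 1/2\<close> is essential: the right side is symmetric under
  \<open>w -> 1 - w\<close>, while the left side in general is not.\<close>

theorem hyp2F1_quadratic:
  fixes a b :: complex and w :: real
  defines "c \<equiv> (a + b + 1) / 2"
  assumes "c \<notin> \<int>\<^sub>\<le>\<^sub>0" and w: "0 \<le> w" "w < 1 / 2"
  shows "hyp2F1 a b c (of_real w) = hyp2F1 (a / 2) (b / 2) c (of_real (4 * w * (1 - w)))"
proof -
  define F where "F = fps_hypergeo [a / 2, b / 2] [c] 1"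
  define P :: "complex fps" where "P = 4 * fps_X * (1 - fps_X)"
  define g where "g = (\<lambda>z::complex. 4 * z * (1 - z))"
  have "fps_hypergeo [a, b] [c] 1 = F oo P"
  proof (rule hypergeo_ode_unique[OF assms(2)])
    show "hypergeo_ode a b c (fps_hypergeo [a, b] [c] 1)"
      by (rule hypergeo_ode_fps_hypergeo[OF assms(2)])
    show "hypergeo_ode a b c (F oo P)"
      unfolding P_def c_def
      by (rule hypergeo_ode_quadratic) (use hypergeo_ode_fps_hypergeo[OF assms(2)] in \<open>simp add: F_def c_def\<close>)
  qed (simp add: F_def)
  moreover have "(hyp2F1 (a / 2) (b / 2) c \<circ> g) has_fps_expansion (F oo P)"
    unfolding F_def
  proof (rule has_fps_expansion_compose[OF has_fps_expansion_hyp2F1])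
    show "g has_fps_expansion P" unfolding g_def P_def by (intro fps_expansion_intros)
  qed (simp add: P_def)
  ultimately have diff: "(\<lambda>z. hyp2F1 a b c z - (hyp2F1 (a / 2) (b / 2) c \<circ> g) z) has_fps_expansion 0"
    using has_fps_expansion_diff[OF has_fps_expansion_hyp2F1[of a b c]] by fastforce
  define S where "S = ball 0 1 \<inter> g -` ball 0 1"
  \<comment> \<open>The condition \<open>norm (g z) < 1\<close> describes the inside of the
    lemniscate \<open>|z(1-z)| = 1/4\<close>, whose two lobes around 0 and 1 touch only at 1/2.
    Hence \<open>S\<close> is disconnected, and continuation from 0 has to stay in the component of
    0.\<close>
  define D where "D = connected_component_set S 0"
  have contg: "continuous_on UNIV g" unfolding g_def by (intro continuous_intros)
  have "open S" unfolding S_def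
    by (intro open_Int open_ball open_vimage contg)
  then have "open D" unfolding D_def by (rule open_connected_component)
  have DS: "D \<subseteq> S" unfolding D_def by (rule connected_component_subset)
  have "0 \<in> S" by (simp add: S_def g_def)
  then have "0 \<in> D" by (simp add: D_def)
  \<comment> \<open>The segment from 0 to \<open>w\<close> lies in \<open>S\<close> because
    \<open>1 - 4v(1-v) = (1-2v)^2 > 0\<close> for \<open>v < 1/2\<close>. It therefore joins
    \<open>w\<close> to 0 inside one component.\<close>
  have seg: "closed_segment 0 (complex_of_real w) \<subseteq> S"
  proof
    fix z assume "z \<in> closed_segment 0 (complex_of_real w)"
    then obtain u where "0 \<le> u" "u \<le> 1" "z = of_real (u * w)"
      by (auto simp: in_segment scaleR_conv_of_real)
    moreover define v where "v = u * w"
    ultimately have v: "0 \<le> v" "v < 1 / 2" "z = of_real v"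
      using w mult_right_mono[of u 1 w] by auto
    have "0 < (1 - 2 * v) * (1 - 2 * v)" using v by (intro mult_pos_pos) auto
    then have "4 * v * (1 - v) < 1" by (simp add: algebra_simps)
    moreover have "0 \<le> 4 * v * (1 - v)" using v by simp
    moreover have "g z = of_real (4 * v * (1 - v))" by (simp add: g_def v(3))
    ultimately have "norm (g z) < 1" by (simp only: norm_of_real)
    then show "z \<in> S" using v by (simp add: S_def)
  qed
  have "of_real w \<in> D"
    unfolding D_def mem_Collect_eq
    by (rule connected_componentI[OF convex_connected[OF convex_closed_segment] seg]) auto
  have "hyp2F1 a b c (of_real w) - (hyp2F1 (a / 2) (b / 2) c \<circ> g) (of_real w) = 0"
  proof (rule has_fps_expansion_0_analytic_continuation[OF diff])
    have "hyp2F1 a b c holomorphic_on D"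
      using holomorphic_on_subset[OF holomorphic_hyp2F1] DS by (auto simp: S_def)
    moreover have "(hyp2F1 (a / 2) (b / 2) c \<circ> g) holomorphic_on D"
    proof (rule holomorphic_on_compose_gen[OF _ holomorphic_hyp2F1])
      show "g holomorphic_on D" unfolding g_def by (intro holomorphic_intros)
      show "g ` D \<subseteq> ball 0 1" using DS by (auto simp: S_def)
    qed
    ultimately show "(\<lambda>z. hyp2F1 a b c z - (hyp2F1 (a / 2) (b / 2) c \<circ> g) z) holomorphic_on D"
      by (rule holomorphic_on_diff)
    show "connected D" by (simp add: D_def)
  qed fact+
  then show ?thesis by (simp add: g_def)
qed

section \<open>Gamma integrals and Gaussian moments\<close>

lemma Gamma_set_integral_lborel:
  fixes z :: complex
  assumes "Re z > 0"
  shows "set_integrable lborel {0<..} (\<lambda>t. of_real t powr (z - 1) * of_real (exp (- t)))"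
    and "(LINT t:{0<..}|lborel. of_real t powr (z - 1) * of_real (exp (- t))) = Gamma z"
proof -
  let ?f = "\<lambda>t::real. of_real t powr (z - 1) * of_real (exp (- t))"
  have eq: "?f = (\<lambda>t. of_real t powr (z - 1) / of_real (exp t))"
    by (simp add: exp_minus field_simps)
  have "set_integrable lebesgue {0<..} ?f"
    unfolding eq by (rule absolutely_integrable_Gamma_integral'[OF assms])
  \<comment> \<open>Integrability is known for the completed measure; Borel measurability of the
    integrand brings it down to \<open>lborel\<close>.\<close>
  moreover have "set_borel_measurable lborel {0<..} ?f"
    unfolding set_borel_measurable_def by measurable
  ultimately show int: "set_integrable lborel {0<..} ?f"
    unfolding set_integrable_def set_borel_measurable_def
    by (simp add: integrable_completion)
  show "(LINT t:{0<..}|lborel. ?f t) = Gamma z"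
    using set_borel_integral_eq_integral(2)[OF int] Gamma_integral_complex'[OF assms]
    unfolding eq by (simp add: integral_unique)
qed

lemma Gamma_set_integral_lborel_real:
  fixes r :: real
  assumes "r > 0"
  shows "set_integrable lborel {0<..} (\<lambda>t. t powr (r - 1) * exp (- t))"
    and "(LINT t:{0<..}|lborel. t powr (r - 1) * exp (- t)) = Gamma r"
proof -
  let ?f = "\<lambda>t::real. of_real t powr (of_real r - 1) * complex_of_real (exp (- t))"
  have r: "Re (of_real r) > 0" using assms by simp
  have eq: "indicator {0<..} t *\<^sub>R ?f t
      = complex_of_real (indicator {0<..} t *\<^sub>R (t powr (r - 1) * exp (- t)))" for t
    by (auto simp: indicator_def powr_of_real[symmetric])
  have i: "integrable lborel
      (\<lambda>t. complex_of_real (indicator {0<..} t *\<^sub>R (t powr (r - 1) * exp (- t))))"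
    using Gamma_set_integral_lborel(1)[OF r] unfolding set_integrable_def eq .
  from integrable_Re[OF i]
  show int: "set_integrable lborel {0<..} (\<lambda>t. t powr (r - 1) * exp (- t))"
    by (simp only: set_integrable_def Re_complex_of_real)
  have "complex_of_real (LINT t:{0<..}|lborel. t powr (r - 1) * exp (- t)) = Gamma (complex_of_real r)"
    using Gamma_set_integral_lborel(2)[OF r]
    unfolding set_lebesgue_integral_def eq by (simp only: integral_complex_of_real)
  then show "(LINT t:{0<..}|lborel. t powr (r - 1) * exp (- t)) = Gamma r"
    by (simp add: Gamma_complex_of_real)
qed

text \<open>The substitution \<open>t = sqrt (u / p)\<close> turns \<open>p t^2\<close> into
  \<open>u\<close>, with \<open>dt = g u / (2u) du\<close>. The facts are stated in the form that
  the substitution rules for interval integrals on \<open>(0, \<infinity>)\<close> ask for.\<close>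

lemma sqrt_scaled_substitution:
  fixes p :: real
  assumes "p > 0"
  defines "g \<equiv> \<lambda>u. sqrt (u / p)"
  shows "u > 0 \<Longrightarrow> DERIV g u :> g u / (2 * u)"
    and "u > 0 \<Longrightarrow> isCont (\<lambda>u. g u / (2 * u)) u"
    and "((ereal \<circ> g \<circ> real_of_ereal) \<longlongrightarrow> 0) (at_right 0)"
    and "((ereal \<circ> g \<circ> real_of_ereal) \<longlongrightarrow> \<infinity>) (at_left \<infinity>)"
proof -
  show "DERIV g u :> g u / (2 * u)" if "u > 0"
  proof -
    have "sqrt (u / p) * sqrt (u / p) = u / p" using assms that by simp
    then show ?thesis unfolding g_def
      using assms that by (auto intro!: derivative_eq_intros simp: field_simps)
  qed
  show "isCont (\<lambda>u. g u / (2 * u)) u" if "u > 0"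
    unfolding g_def by (intro continuous_intros) (use assms that in auto)
  have "(g \<longlongrightarrow> sqrt (0 / p)) (at_right 0)"
    unfolding g_def by (intro tendsto_intros) (use assms in auto)
  then show "((ereal \<circ> g \<circ> real_of_ereal) \<longlongrightarrow> 0) (at_right 0)"
    by (simp add: zero_ereal_def ereal_tendsto_simps)
  have "filterlim (\<lambda>u. u / p) at_top at_top"
    using filterlim_tendsto_pos_mult_at_top[OF tendsto_const[of "inverse p"] _ filterlim_ident] assms
    by (simp add: field_simps)
  then have "filterlim g at_top at_top"
    unfolding g_def by (rule filterlim_compose[OF sqrt_at_top])
  then show "((ereal \<circ> g \<circ> real_of_ereal) \<longlongrightarrow> \<infinity>) (at_left \<infinity>)"
    by (simp add: ereal_tendsto_simps)
qed

text \<open>For a nonnegative integrand, the substitution rule yields integrability of the Gaussian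
  side along with its value. The real case thus comes first and later serves as a dominating
  function.\<close>

lemma Gaussian_moment_real:
  fixes p r :: real
  assumes "p > 0" "r > 0"
  shows "set_integrable lborel {0<..} (\<lambda>t. t powr (2 * r - 1) * exp (- p * t\<^sup>2))"
    and "(LINT t:{0<..}|lborel. t powr (2 * r - 1) * exp (- p * t\<^sup>2)) = p powr (- r) * Gamma r / 2"
proof -
  let ?f = "\<lambda>t::real. t powr (2 * r - 1) * exp (- p * t\<^sup>2)"
  define g where "g = (\<lambda>u::real. sqrt (u / p))"
  have eq: "?f (g u) * (g u / (2 * u)) = (p powr (- r) / 2) * (u powr (r - 1) * exp (- u))" if "u > 0" for u
  proof -
    have gp: "g u > 0" using that assms by (simp add: g_def)
    have "g u powr (2 * r - 1) * g u = g u powr (2 * r)"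
      using gp by (simp add: powr_diff)
    also have "\<dots> = (u / p) powr r"
      using that assms by (simp add: g_def powr_half_sqrt[symmetric] powr_powr)
    also have "\<dots> = p powr (- r) * (u powr (r - 1) * u)"
      using that assms by (simp add: powr_divide powr_minus powr_diff field_simps)
    finally have *: "g u powr (2 * r - 1) * g u = p powr (- r) * (u powr (r - 1) * u)" .
    have "p * (g u)\<^sup>2 = u" using that assms by (simp add: g_def)
    then have "?f (g u) * (g u / (2 * u)) = (g u powr (2 * r - 1) * g u) * exp (- u) / (2 * u)" by simp
    then show ?thesis unfolding * using that by (simp add: field_simps)
  qed
  have gpos: "g u > 0" if "u > 0" for u using that assms by (simp add: g_def)
  have gnn: "g u / (2 * u) \<ge> 0" if "u \<ge> 0" for u using that assms by (simp add: g_def)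
  have contf: "isCont ?f t" if "t > 0" for t
    by (intro continuous_intros) (use that in \<open>auto simp: complex_nonpos_Reals_iff\<close>)
  have "sqrt (u / p) = g u" for u by (simp add: g_def)
  note sub = sqrt_scaled_substitution[OF assms(1), unfolded this]
  have eint: "einterval 0 \<infinity> = {0<..}" by (auto simp: einterval_def zero_ereal_def)
  have int: "set_integrable lborel (einterval 0 \<infinity>) (\<lambda>u. ?f (g u) * (g u / (2 * u)))"
    unfolding eint
    by (subst set_integrable_cong[OF refl refl eq])
       (use Gamma_set_integral_lborel_real(1)[OF assms(2)] in \<open>auto simp del: mult_minus_left\<close>)
  have *: "set_integrable lborel (einterval 0 \<infinity>) ?f"
    and **: "(LBINT t=0..\<infinity>. ?f t) = (LBINT u=0..\<infinity>. ?f (g u) * (g u / (2 * u)))"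
    by (rule interval_integral_substitution_nonneg[where f = ?f and g = g, OF _ _ _ _ _ _ sub(3,4) int];
        use sub(1,2) contf gpos gnn in \<open>auto simp: less_imp_le\<close>)+
  show "set_integrable lborel {0<..} ?f" using * unfolding eint .
  have "(LINT t:{0<..}|lborel. ?f t) = (LINT u:{0<..}|lborel. ?f (g u) * (g u / (2 * u)))"
    using ** by (simp add: interval_lebesgue_integral_def eint)
  also have "\<dots> = (LINT u:{0<..}|lborel. (p powr (- r) / 2) * (u powr (r - 1) * exp (- u)))"
    by (intro set_lebesgue_integral_cong) (use eq in auto)
  also have "\<dots> = p powr (- r) * Gamma r / 2"
    unfolding set_integral_mult_right Gamma_set_integral_lborel_real(2)[OF assms(2)] by simp
  finally show "(LINT t:{0<..}|lborel. ?f t) = p powr (- r) * Gamma r / 2" .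
qed

text \<open>The substitution rule for complex integrands takes integrability of both sides as input.
  On the Gaussian side it follows from the real moment, as \<open>t powr w\<close> has norm
  \<open>t powr Re w\<close> for \<open>t > 0\<close>.\<close>

lemma Gaussian_moment_complex:
  fixes p :: real and z :: complex
  assumes "p > 0" "Re z > 0"
  shows "set_integrable lborel {0<..} (\<lambda>t. of_real t powr (2 * z - 1) * of_real (exp (- p * t\<^sup>2)))"
    and "(LINT t:{0<..}|lborel. of_real t powr (2 * z - 1) * of_real (exp (- p * t\<^sup>2)))
           = of_real p powr (- z) * Gamma z / 2"
proof -
  let ?f = "\<lambda>t::real. of_real t powr (2 * z - 1) * complex_of_real (exp (- p * t\<^sup>2))"
  show int0: "set_integrable lborel {0<..} ?f"
    unfolding set_integrable_def
  proof (rule Bochner_Integration.integrable_bound)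
    show "integrable lborel (\<lambda>t. indicator {0<..} t *\<^sub>R (t powr (2 * Re z - 1) * exp (- p * t\<^sup>2)))"
      using Gaussian_moment_real(1)[OF assms] unfolding set_integrable_def .
  qed (auto simp: indicator_def norm_mult norm_powr_real_powr)
  define g where "g = (\<lambda>u::real. sqrt (u / p))"
  have eq: "(g u / (2 * u)) *\<^sub>R ?f (g u)
      = (of_real p powr (- z) / 2) * (of_real u powr (z - 1) * of_real (exp (- u)))" if "u > 0" for u
  proof -
    have gp: "g u > 0" using that assms by (simp add: g_def)
    \<comment> \<open>All bases are positive reals, so the complex powers reduce to exponentials of
      real logarithms and no branch problem arises.\<close>
    have lng: "ln (g u) = (ln u - ln p) / 2"
      using that assms by (simp add: g_def ln_sqrt ln_div)
    have "of_real (g u) powr (2 * z - 1) * of_real (g u) = (of_real (g u) :: complex) powr (2 * z)"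
      using gp by (simp add: powr_diff)
    also have "\<dots> = exp (z * (of_real (ln u) - of_real (ln p)))"
      using gp by (simp add: powr_def Ln_of_real lng)
    also have "\<dots> = of_real p powr (- z) * of_real u powr z"
      using that assms by (simp add: powr_def Ln_of_real exp_add[symmetric] algebra_simps)
    also have "\<dots> = of_real p powr (- z) * (of_real u powr (z - 1) * of_real u)"
      using that by (simp add: powr_diff)
    finally have *: "of_real (g u) powr (2 * z - 1) * of_real (g u)
        = of_real p powr (- z) * (of_real u powr (z - 1) * (of_real u :: complex))" .
    have "p * (g u)\<^sup>2 = u" using that assms by (simp add: g_def)
    then have "(g u / (2 * u)) *\<^sub>R ?f (g u)
        = (of_real (g u) powr (2 * z - 1) * of_real (g u)) * of_real (exp (- u)) / (2 * of_real u)"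
      by (simp add: scaleR_conv_of_real)
    then show ?thesis unfolding * using that by (simp add: field_simps)
  qed
  have gpos: "g u > 0" if "u > 0" for u using that assms by (simp add: g_def)
  have gnn: "g u / (2 * u) \<ge> 0" if "u \<ge> 0" for u using that assms by (simp add: g_def)
  have contf: "isCont ?f t" if "t > 0" for t
    by (intro continuous_intros) (use that in \<open>auto simp: complex_nonpos_Reals_iff\<close>)
  have "sqrt (u / p) = g u" for u by (simp add: g_def)
  note sub = sqrt_scaled_substitution[OF assms(1), unfolded this]
  have eint: "einterval 0 \<infinity> = {0<..}" by (auto simp: einterval_def zero_ereal_def)
  have int: "set_integrable lborel (einterval 0 \<infinity>) (\<lambda>u. (g u / (2 * u)) *\<^sub>R ?f (g u))"
    unfolding eint
    by (subst set_integrable_cong[OF refl refl eq])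
       (use Gamma_set_integral_lborel(1)[OF assms(2)] in \<open>auto simp del: mult_minus_left\<close>)
  have *: "(LBINT t=0..\<infinity>. ?f t) = (LBINT u=0..\<infinity>. (g u / (2 * u)) *\<^sub>R ?f (g u))"
    by (rule interval_integral_substitution_integrable[where f = ?f and g = g, OF _ _ _ _ _ sub(3,4) int int0[folded eint]];
        use sub(1,2) contf gpos gnn in \<open>auto simp: less_imp_le\<close>)
  have "(LINT t:{0<..}|lborel. ?f t) = (LINT u:{0<..}|lborel. (g u / (2 * u)) *\<^sub>R ?f (g u))"
    using * by (simp add: interval_lebesgue_integral_def eint)
  also have "\<dots> = (LINT u:{0<..}|lborel. (of_real p powr (- z) / 2) * (of_real u powr (z - 1) * of_real (exp (- u))))"
    by (intro set_lebesgue_integral_cong) (use eq in auto)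
  also have "\<dots> = of_real p powr (- z) * Gamma z / 2"
    unfolding set_integral_mult_right Gamma_set_integral_lborel(2)[OF assms(2)] by simp
  finally show "(LINT t:{0<..}|lborel. ?f t) = of_real p powr (- z) * Gamma z / 2" .
qed

section \<open>Termwise integration of the \<open>2F2\<close> series\<close>

text \<open>The moment of order \<open>n\<close> contributes
  \<open>Gamma (s/2 + n) = (s/2)_n Gamma (s/2)\<close>, which cancels \<open>(s/2)_n\<close> in the
  denominator, and \<open>p^(-n)\<close>, which turns \<open>q^n\<close> into
  \<open>(q/p)^n\<close>. Sum and integral may be exchanged because the integrals of the norms are
  summable, their ratio tending to \<open>q/p < 1\<close>.\<close>

lemma Gaussian_integral_hyp2F2:
  fixes a b c s :: complex and p q :: real
  assumes s: "Re s > 0" and c: "c \<notin> \<int>\<^sub>\<le>\<^sub>0" and p: "p > 0" and q: "0 \<le> q" "q < p"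
  defines "f \<equiv> \<lambda>t::real. of_real t powr (s - 1) * of_real (exp (- p * t\<^sup>2))
      * hyp2F2 a b (s / 2) c (of_real (q * t\<^sup>2))"
  shows "set_integrable lborel {0<..} f"
    and "(LINT t:{0<..}|lborel. f t)
           = of_real p powr (- s / 2) * Gamma (s / 2) / 2 * hyp2F1 a b c (of_real (q / p))"
proof -
  define A where "A = (\<lambda>n. pochhammer a n * pochhammer b n / (pochhammer (s / 2) n * pochhammer c n) / fact n)"
  have A_Suc: "A (Suc n) = (a + of_nat n) / (s / 2 + of_nat n) * ((b + of_nat n) / (c + of_nat n)) / of_nat (Suc n) * A n" for n
    unfolding A_def by (simp only: pochhammer_rec' fact_Suc of_nat_mult of_nat_fact times_divide_times_eq
        times_divide_eq_right times_divide_eq_left divide_divide_eq_left) (simp only: ac_simps)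
  define \<sigma> where "\<sigma> = Re s / 2"
  have \<sigma>: "\<sigma> > 0" using s by (simp add: \<sigma>_def)
  \<comment> \<open>The factor \<open>t^(2n)\<close> of the series term is absorbed into the power
    of \<open>t\<close>, which makes \<open>m n\<close> a Gaussian moment integrand with parameter
    \<open>s/2 + n\<close>.\<close>
  define m where "m = (\<lambda>n t. complex_of_real t powr (2 * (s / 2 + of_nat n) - 1) * of_real (exp (- p * t\<^sup>2)))"
  define F where "F = (\<lambda>n t. indicator {0<..} t *\<^sub>R (A n * of_real q ^ n * m n t))"
  have pos: "Re (s / 2 + of_nat n) > 0" for n using s by simp
  have F_eq: "F n t = indicator {0<..} t *\<^sub>R (of_real t powr (s - 1) * of_real (exp (- p * t\<^sup>2))
      * (A n * of_real (q * t\<^sup>2) ^ n))" for n t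
  proof (cases "t > 0")
    case True
    have "complex_of_real t powr (2 * (s / 2 + of_nat n) - 1) = of_real t powr ((s - 1) + of_nat (2 * n))"
      by (simp add: algebra_simps)
    also have "\<dots> = of_real t powr (s - 1) * of_real t ^ (2 * n)"
      using True powr_nat'[of "of_real t" "2 * n"] by (simp add: powr_add del: of_nat_mult)
    finally show ?thesis
      by (simp add: F_def m_def power_mult power_mult_distrib)
  qed (simp add: F_def)
  have int: "integrable lborel (F n)" for n
    using Gaussian_moment_complex(1)[OF p pos, of n, THEN set_integrable_mult_right, of "A n * of_real q ^ n"]
    by (simp add: set_integrable_def F_def m_def)
  have val: "(LINT t|lborel. F n t) = of_real p powr (- s / 2) * Gamma (s / 2) / 2
      * (pochhammer a n * pochhammer b n / pochhammer c n * (of_real (q / p) ^ n / fact n))" for n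
  proof -
    have nz: "s / 2 \<notin> \<int>\<^sub>\<le>\<^sub>0" using s by (auto elim!: nonpos_Ints_cases)
    have G: "Gamma (s / 2 + of_nat n) = pochhammer (s / 2) n * Gamma (s / 2)"
      using pochhammer_Gamma[OF nz, of n] nz by (simp add: Gamma_eq_zero_iff)
    have P: "pochhammer (s / 2) n \<noteq> 0" using nz pochhammer_eq_0_imp_nonpos_Int by blast
    have pw: "complex_of_real p powr (- (s / 2 + of_nat n)) = of_real p powr (- s / 2) / of_real p ^ n"
      using p by (simp add: powr_diff powr_nat')
    have "(LINT t|lborel. F n t) = A n * of_real q ^ n * (LINT t:{0<..}|lborel. m n t)"
      unfolding set_integral_mult_right[symmetric] by (simp only: F_def set_lebesgue_integral_def)
    also have "\<dots> = A n * of_real q ^ n * (of_real p powr (- (s / 2 + of_nat n)) * Gamma (s / 2 + of_nat n) / 2)"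
      unfolding m_def using Gaussian_moment_complex(2)[OF p pos, of n] by simp
    finally show ?thesis
      unfolding G pw A_def using P p by (simp add: power_divide mult_ac)
  qed
  have norm_val: "(LINT t|lborel. norm (F n t))
      = norm (A n) * q ^ n * (p powr (- (\<sigma> + real n)) * Gamma (\<sigma> + real n) / 2)" for n
  proof -
    have pos': "\<sigma> + real n > 0" using \<sigma> by simp
    have "norm (F n t) = indicator {0<..} t *\<^sub>R (norm (A n) * q ^ n * (t powr (2 * (\<sigma> + real n) - 1) * exp (- p * t\<^sup>2)))" for t
      using q by (auto simp: F_def m_def \<sigma>_def indicator_def norm_mult norm_power norm_powr_real_powr)
    then have "(LINT t|lborel. norm (F n t))
        = norm (A n) * q ^ n * (LINT t:{0<..}|lborel. t powr (2 * (\<sigma> + real n) - 1) * exp (- p * t\<^sup>2))"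
      unfolding set_integral_mult_right[symmetric] by (simp only: set_lebesgue_integral_def)
    then show ?thesis unfolding Gaussian_moment_real(2)[OF p pos'] .
  qed
  \<comment> \<open>For fixed \<open>t\<close> the term ratio tends to 0, since \<open>2F2\<close>
    has as many lower as upper parameters and the factorial remains.\<close>
  have summ: "summable (\<lambda>n. norm (F n t))" for t
  proof -
    let ?g = "\<lambda>n. A n * of_real (q * t\<^sup>2) ^ n"
    let ?R = "\<lambda>n. norm ((a + of_nat n) / (s / 2 + of_nat n)) * norm ((b + of_nat n) / (c + of_nat n))
        * inverse (real (Suc n)) * (q * t\<^sup>2)"
    have "summable (\<lambda>n. norm (?g n))"
    proof (rule summable_ratio_limit[where R = ?R])
      have "?R \<longlonglongrightarrow> norm (1::complex) * norm (1::complex) * 0 * (q * t\<^sup>2)"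
        by (intro tendsto_intros tendsto_shifted_ratio LIMSEQ_inverse_real_of_nat)
      then show "?R \<longlonglongrightarrow> 0" by simp
      fix n
      have "?g (Suc n) = (a + of_nat n) / (s / 2 + of_nat n) * ((b + of_nat n) / (c + of_nat n))
          * of_real (inverse (real (Suc n))) * of_real (q * t\<^sup>2) * ?g n"
        unfolding A_Suc power_Suc by (simp only: divide_inverse of_real_inverse of_real_of_nat_eq mult_ac)
      moreover have "0 \<le> q * t\<^sup>2" "0 \<le> inverse (real (Suc n))" using q by simp_all
      ultimately have "norm (?g (Suc n)) = ?R n * norm (?g n)"
        by (simp only: norm_mult norm_of_real abs_of_nonneg)
      then show "norm (norm (?g (Suc n))) = ?R n * norm (norm (?g n))"
        unfolding real_norm_def abs_norm_cancel .
      show "(0::real) < 1" by simp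
    qed
    then have "summable (\<lambda>n. norm (indicator {0<..} t *\<^sub>R (of_real t powr (s - 1) * complex_of_real (exp (- p * t\<^sup>2)))) * norm (?g n))"
      by (rule summable_mult)
    moreover have "norm (F n t) = norm (indicator {0<..} t *\<^sub>R (of_real t powr (s - 1) * complex_of_real (exp (- p * t\<^sup>2)))) * norm (?g n)" for n
      unfolding F_eq by (simp add: norm_mult)
    ultimately show ?thesis by (simp only:)
  qed
  \<comment> \<open>Taking norms replaces \<open>s/2\<close> by its real part in the moment but not
    in \<open>A n\<close>, so the Pochhammer factor no longer cancels exactly. The leftover
    quotients still tend to 1, leaving the limit \<open>q / p\<close>.\<close>
  have summ_int: "summable (\<lambda>n. LINT t|lborel. norm (F n t))"
  proof -
    let ?R = "\<lambda>n. norm ((a + of_nat n) / (s / 2 + of_nat n)) * norm ((b + of_nat n) / (c + of_nat n))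
        * ((\<sigma> + real n) / (1 + real n)) * (q / p)"
    let ?T = "\<lambda>n. norm (A n) * q ^ n * (p powr (- (\<sigma> + real n)) * Gamma (\<sigma> + real n) / 2)"
    show ?thesis
      unfolding norm_val
    proof (rule summable_ratio_limit[where R = ?R])
      have "?R \<longlonglongrightarrow> norm (1::complex) * norm (1::complex) * 1 * (q / p)"
        by (intro tendsto_intros tendsto_shifted_ratio)
      then show "?R \<longlonglongrightarrow> q / p" by simp
      show "q / p < 1" using p q by simp
      fix n
      have nz: "\<sigma> + real n \<notin> \<int>\<^sub>\<le>\<^sub>0" using \<sigma> by (auto elim!: nonpos_Ints_cases)
      have G: "Gamma (\<sigma> + real (Suc n)) = (\<sigma> + real n) * Gamma (\<sigma> + real n)"
        using Gamma_plus1[OF nz] by (simp add: ac_simps)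
      have pw: "p powr (- (\<sigma> + real (Suc n))) = p powr (- (\<sigma> + real n)) / p"
      proof -
        have "- (\<sigma> + real (Suc n)) = - (\<sigma> + real n) - 1" by simp
        then show ?thesis using p by (simp only: powr_diff powr_one less_imp_le)
      qed
      show "norm (?T (Suc n)) = ?R n * norm (?T n)"
      proof -
        have nonneg: "?T k \<ge> 0" for k
        proof -
          have "Gamma (\<sigma> + real k) > 0" by (rule Gamma_real_pos) (use \<sigma> in simp)
          then show ?thesis using q by simp
        qed
        have "norm (A (Suc n)) = norm ((a + of_nat n) / (s / 2 + of_nat n)) * norm ((b + of_nat n) / (c + of_nat n))
            / (1 + real n) * norm (A n)"
          unfolding A_Suc norm_mult norm_divide norm_of_nat by (simp only: of_nat_Suc)
        then have "?T (Suc n) = ?R n * ?T n"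
          unfolding G pw power_Suc by (simp only: divide_inverse mult_ac)
        then show ?thesis
          unfolding real_norm_def abs_of_nonneg[OF nonneg] .
      qed
    qed
  qed
  have sum_F: "(\<Sum>n. F n t) = indicator {0<..} t *\<^sub>R f t" for t
  proof -
    have "summable (\<lambda>n. A n * of_real (q * t\<^sup>2) ^ n)" if "t > 0"
    proof -
      have "summable (\<lambda>n. F n t)" using summ by (rule summable_norm_cancel)
      then have "summable (\<lambda>n. (of_real t powr (s - 1) * of_real (exp (- p * t\<^sup>2))) * (A n * of_real (q * t\<^sup>2) ^ n))"
        unfolding F_eq using that by simp
      \<comment> \<open>For \<open>t > 0\<close> the common prefactor is nonzero and can be
        cancelled from the summable series.\<close>
      then show ?thesis using that by (subst (asm) summable_cmult_iff) auto
    qed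
    from suminf_mult[OF this, of "of_real t powr (s - 1) * of_real (exp (- p * t\<^sup>2))"]
    show ?thesis
      by (cases "t > 0") (simp_all add: F_eq f_def hyp2F2_series A_def mult_ac)
  qed
  note F = int AE_I2[of lborel, OF summ] summ_int
  show "set_integrable lborel {0<..} f"
    using integrable_suminf[OF F] unfolding set_integrable_def sum_F by simp
  have "(LINT t:{0<..}|lborel. f t) = (\<Sum>n. LINT t|lborel. F n t)"
    using integral_suminf[OF F] unfolding set_lebesgue_integral_def sum_F by simp
  also have "\<dots> = of_real p powr (- s / 2) * Gamma (s / 2) / 2 * hyp2F1 a b c (of_real (q / p))"
  proof -
    let ?h = "\<lambda>n. fps_nth (fps_hypergeo [a, b] [c] 1) n * of_real (q / p) ^ n"
    have "summable ?h"
      by (rule summable_fps, rule less_le_trans[OF _ fps_conv_radius_hypergeo_2F1])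
         (use p q in \<open>simp add: one_ereal_def norm_divide\<close>)
    moreover have "?h n = pochhammer a n * pochhammer b n / pochhammer c n * (of_real (q / p) ^ n / fact n)" for n
      by simp
    ultimately have "summable (\<lambda>n. pochhammer a n * pochhammer b n / pochhammer c n * (of_real (q / p) ^ n / fact n))"
      by (simp only:)
    then show ?thesis
      unfolding val hyp2F1_series by (rule suminf_mult)
  qed
  finally show "(LINT t:{0<..}|lborel. f t)
      = of_real p powr (- s / 2) * Gamma (s / 2) / 2 * hyp2F1 a b c (of_real (q / p))" .
qed

section \<open>Specialisation to the stated integral\<close>

theorem mainTheorem12:
  fixes \<mu> \<nu> :: complex and x y :: real
  assumes "Re (\<mu> + \<nu>) < 0" and "x > 0" and "y > 0"
  defines "f \<equiv> (\<lambda>t::real.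
      complex_of_real t powr (- (1 + \<mu> + \<nu>))
      * exp (- complex_of_real ((x + y) / (4 * x * y) * t^2))
      * hyp2F2 (- \<mu>) (- \<nu>) (- (\<mu> + \<nu>) / 2) ((1 - \<mu> - \<nu>) / 2)
          (complex_of_real (t^2 / (8 * x))))"
  shows "set_integrable lborel {0<..} f \<and>
    (LINT t:{0<..}|lborel. f t) =
      2 powr (- (1 + \<mu> + \<nu>)) * Gamma (- (\<mu> + \<nu>) / 2)
      * complex_of_real ((x + y) / (x * y)) powr ((\<mu> + \<nu>) / 2)
      * hyp2F1 (- \<mu> / 2) (- \<nu> / 2) ((1 - \<mu> - \<nu>) / 2)
          (complex_of_real (y * (2 * x + y) / (x + y)^2))"
proof -
  define s where "s = - (\<mu> + \<nu>)"
  define c where "c = (1 - \<mu> - \<nu>) / 2"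
  define p q where "p = (x + y) / (4 * x * y)" and "q = 1 / (8 * x)"
  have s: "Re s > 0" using assms(1) by (simp add: s_def)
  have "Re c > 0" using assms(1) by (simp add: c_def)
  then have c: "c \<notin> \<int>\<^sub>\<le>\<^sub>0" by (auto elim!: nonpos_Ints_cases)
  have p: "p > 0" and q: "0 \<le> q" using assms(2,3) by (simp_all add: p_def q_def)
  \<comment> \<open>This quotient is the argument \<open>w\<close> of the quadratic transformation.
    Its bound by 1/2 also yields \<open>q < p\<close>, as termwise integration requires.\<close>
  have qp: "q / p = y / (2 * (x + y))" using assms(2,3) by (simp add: p_def q_def field_simps)
  have "q / p < 1 / 2" unfolding qp using assms(2,3) by (simp add: divide_simps)
  then have "q < p" using p by (simp add: field_simps)
  have f: "f = (\<lambda>t. of_real t powr (s - 1) * of_real (exp (- p * t\<^sup>2))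
      * hyp2F2 (- \<mu>) (- \<nu>) (s / 2) c (of_real (q * t\<^sup>2)))"
  proof -
    have "- (1 + \<mu> + \<nu>) = s - 1" by (simp add: s_def)
    moreover have "complex_of_real (exp (- p * t\<^sup>2)) = exp (- of_real (p * t\<^sup>2))" for t
      by (simp flip: exp_of_real)
    moreover have "t\<^sup>2 / (8 * x) = q * t\<^sup>2" for t by (simp add: q_def)
    ultimately show ?thesis
      by (simp only: f_def p_def[symmetric] c_def[symmetric] s_def[symmetric])
  qed
  note main = Gaussian_integral_hyp2F2[OF s c p q \<open>q < p\<close>, of "- \<mu>" "- \<nu>", folded f]
  have arg: "4 * (q / p) * (1 - q / p) = y * (2 * x + y) / (x + y)\<^sup>2"
  proof -
    have "1 - q / p = (2 * x + y) / (2 * (x + y))" unfolding qp using assms(2,3) by (simp add: field_simps)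
    then show ?thesis unfolding qp by (simp add: power2_eq_square del: distrib_left_numeral)
  qed
  \<comment> \<open>The lower parameter is exactly the value \<open>(a + b + 1)/2\<close> with
    \<open>a = -\<mu>\<close>, \<open>b = -\<nu>\<close> demanded by the quadratic
    transformation.\<close>
  have cc: "(- \<mu> + - \<nu> + 1) / 2 = c" by (simp add: c_def)
  have quad: "hyp2F1 (- \<mu>) (- \<nu>) c (of_real (q / p))
      = hyp2F1 (- \<mu> / 2) (- \<nu> / 2) c (of_real (y * (2 * x + y) / (x + y)\<^sup>2))"
    by (rule hyp2F1_quadratic[of "- \<mu>" "- \<nu>" "q / p", unfolded cc arg,
          OF c divide_nonneg_pos[OF q p] \<open>q / p < 1 / 2\<close>])
  \<comment> \<open>Since \<open>p\<close> is a quarter of \<open>(x + y)/(xy)\<close>, its power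
    \<open>-s/2\<close> produces an extra \<open>2 powr s\<close>.\<close>
  have "complex_of_real p powr (- s / 2) = of_real ((x + y) / (x * y)) powr (- s / 2) * 2 powr s"
  proof -
    have lnp: "ln p = ln ((x + y) / (x * y)) - 2 * ln 2"
    proof -
      have "p = ((x + y) / (x * y)) / 2\<^sup>2" by (simp add: p_def)
      moreover have "(x + y) / (x * y) > 0" using assms(2,3) by simp
      ultimately show ?thesis by (simp only: ln_divide_pos ln_realpow zero_less_power zero_less_numeral of_nat_numeral)
    qed
    have "(x + y) / (x * y) > 0" using assms(2,3) by simp
    moreover have "Ln 2 = complex_of_real (ln 2)" using Ln_of_real[of 2] by simp
    ultimately show ?thesis
      using assms(2,3) p by (simp add: powr_def Ln_of_real lnp exp_add[symmetric] algebra_simps del: of_real_divide)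
  qed
  \<comment> \<open>The 1/2 from the Gaussian moment lowers \<open>2 powr s\<close> to
    \<open>2 powr (s - 1)\<close>, the constant in the claim.\<close>
  moreover have "2 powr s = 2 * (2 powr (- (1 + \<mu> + \<nu>)) :: complex)"
    by (simp add: s_def powr_diff powr_minus powr_add field_simps)
  ultimately have "complex_of_real p powr (- s / 2) / 2
      = 2 powr (- (1 + \<mu> + \<nu>)) * of_real ((x + y) / (x * y)) powr (- s / 2)"
    by (simp only:) (simp add: mult_ac)
  moreover have "complex_of_real p powr (- s / 2) * Gamma (s / 2) / 2
      = complex_of_real p powr (- s / 2) / 2 * Gamma (s / 2)"
    by simp
  ultimately have "complex_of_real p powr (- s / 2) * Gamma (s / 2) / 2
      = 2 powr (- (1 + \<mu> + \<nu>)) * Gamma (s / 2) * of_real ((x + y) / (x * y)) powr (- s / 2)"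
    by (simp only: mult_ac)
  moreover have "- s / 2 = (\<mu> + \<nu>) / 2" by (simp add: s_def)
  ultimately show ?thesis
    using main unfolding quad by (simp only: s_def c_def)
qed

end
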